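(* Let $(X,<)$ be a finite nonempty strict poset and let $\varepsilon\ge 0$ be a real number. Then for every partial dendrogram $\theta\in\mathcal{PD}(X,<)$, $$\Psi_X(\kappa_\varepsilon(\theta)) = \mathfrak{U}_\varepsilon(\theta),$$ that is, $\Psi_X\circ\kappa_\varepsilon=\mathfrak{U}_\varepsilon$.
   Context: $\mathbb{R}_+$ denotes the non-negative reals. For a finite set $Y$, the partitions of $Y$ are ordered by refinement ($\mathcal A\le\mathcal B$ iff every block of $\mathcal A$ is contained in a block of $\mathcal B$); $S(Y)$ is the singleton partition and $\{Y\}$ the trivial partition. Regular partitions: for an equivalence relation $\mathscr R$ on $X$ let $S$ be the transitive closure of the relation $S_0$ on $X/\mathscr{R}$ defined by $([a],[b])\in S_0\iff\exists x\in[a],y\in[b]:x<y$. The partition $X/\mathscr{R}$ of $(X,<)$ is regular if $S$ is a strict partial order (irreflexive and transitive) on $X/\mathscr R$. Partial dendrograms: $\mathcal{PD}(X,<)$ is the set of order preserving (monotone) maps $\theta$ from $(\mathbb{R}_+,\le)$ to the regular partitions of $(X,<)$ such that (D1) for every $t\in\mathbb{R}_+$ there is $\delta>0$ with $\theta(t)=\theta(t+\delta)$, and (D3) $\theta(0)=S(X)$. A monotone map $\theta$ from $\mathbb{R}_+$ to all partitions of a set $Y$ satisfying D1, D3 and (D2) $\theta(t_0)=\{Y\}$ for some $t_0>0$ is a (complete) dendrogram over $Y$. A partial dendrogram is eventually constant; $\theta(\infty)$ denotes its eventual value (its maximal partition), and $\operatorname{diam}(\theta)=\min\{t\in\mathbb{R}_+\mid\theta(t)=\theta(\infty)\}$.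 For a finite set $Y$ and a monotone map $\eta$ from $\mathbb{R}_+$ to partitions of $Y$ satisfying D1 and D2, $\Psi_Y(\eta):Y\times Y\to\mathbb{R}_+$ is $$\Psi_Y(\eta)(x,y)=\min\{t\in\mathbb{R}_+\mid \exists B\in\eta(t):x,y\in B\}.$$ Completion of dendrograms: $\kappa_\varepsilon(\theta)(t)=\theta(t)$ if $t<\operatorname{diam}(\theta)+\varepsilon$, and $\kappa_\varepsilon(\theta)(t)=\{X\}$ otherwise. Ultrametric completion: let $\theta(\infty)=\{B_j\}_{j=1}^k$ and for each $j$ let $\theta_j$ be the complete dendrogram over $B_j$ given by $\theta_j(t)=\{B_j\cap B'\mid B'\in\theta(t),\,B_j\cap B'\ne\emptyset\}$. Then $$\mathfrak{U}_\varepsilon(\theta)(x,y)=\begin{cases}\Psi_{B_j}(\theta_j)(x,y)&\text{if } x,y\in B_j\text{ for some }j,\\ \operatorname{diam}(\theta)+\varepsilon&\text{otherwise.}\end{cases}$$ *)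

theory Defs
  imports Complex_Main "HOL-Library.Disjoint_Sets" "HOL-Library.FuncSet"
begin

definition strict_poset :: "'a set \<Rightarrow> 'a rel \<Rightarrow> bool" where
  "strict_poset X r \<longleftrightarrow> r \<subseteq> X \<times> X \<and> irrefl_on X r \<and> trans r"

definition block_rel :: "'a rel \<Rightarrow> 'a set set \<Rightarrow> 'a set rel" where
  "block_rel r P = {(A, B). A \<in> P \<and> B \<in> P \<and> (\<exists>x\<in>A. \<exists>y\<in>B. (x, y) \<in> r)}"

definition regular_partitions :: "'a set \<Rightarrow> 'a rel \<Rightarrow> 'a set set set" where
  "regular_partitions X r =
     {X // R | R. equiv X R \<and> strict_poset (X // R) ((block_rel r (X // R))\<^sup>+)}"

definition singleton_partition :: "'a set \<Rightarrow> 'a set set" where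
  "singleton_partition Y = (\<lambda>y. {y}) ` Y"

(* Maps on the non-negative reals are functions on real that are extensional on {0..}. *)

definition partial_dendrograms :: "'a set \<Rightarrow> 'a rel \<Rightarrow> (real \<Rightarrow> 'a set set) set" where
  "partial_dendrograms X r =
     {\<theta> \<in> {0..} \<rightarrow>\<^sub>E regular_partitions X r.
        monotone_on {0..} (\<le>) (refines X) \<theta> \<and>
        (\<forall>t\<ge>0. \<exists>\<delta>>0. \<theta> t = \<theta> (t + \<delta>)) \<and>
        \<theta> 0 = singleton_partition X}"

definition eventual_partition :: "(real \<Rightarrow> 'a set set) \<Rightarrow> 'a set set" where
  "eventual_partition \<theta> = (THE P. \<forall>\<^sub>F t in at_top. \<theta> t = P)"

(* All minima below are attained for the intended arguments, since dendrograms
   are locally constant to the right. *)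

definition diam :: "(real \<Rightarrow> 'a set set) \<Rightarrow> real" where
  "diam \<theta> = (LEAST t. 0 \<le> t \<and> \<theta> t = eventual_partition \<theta>)"

definition dendrogram_ultrametric ::
    "'a set \<Rightarrow> (real \<Rightarrow> 'a set set) \<Rightarrow> 'a \<times> 'a \<Rightarrow> real" (\<open>\<Psi>\<close>) where
  "\<Psi> Y \<eta> = (\<lambda>(x, y)\<in>Y \<times> Y. LEAST t. 0 \<le> t \<and> (\<exists>B\<in>\<eta> t. x \<in> B \<and> y \<in> B))"

definition dendrogram_completion ::
    "'a set \<Rightarrow> real \<Rightarrow> (real \<Rightarrow> 'a set set) \<Rightarrow> real \<Rightarrow> 'a set set" (\<open>\<kappa>\<close>) where
  "\<kappa> X \<epsilon> \<theta> = (\<lambda>t\<in>{0..}. if t < diam \<theta> + \<epsilon> then \<theta> t else {X})"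

definition block_dendrogram ::
    "(real \<Rightarrow> 'a set set) \<Rightarrow> 'a set \<Rightarrow> real \<Rightarrow> 'a set set" where
  "block_dendrogram \<theta> B = (\<lambda>t\<in>{0..}. {B \<inter> B' | B'. B' \<in> \<theta> t \<and> B \<inter> B' \<noteq> {}})"

(* The THE picks the unique block of the eventual partition containing both points. *)

definition ultrametric_completion ::
    "'a set \<Rightarrow> real \<Rightarrow> (real \<Rightarrow> 'a set set) \<Rightarrow> 'a \<times> 'a \<Rightarrow> real" (\<open>\<UU>\<close>) where
  "\<UU> X \<epsilon> \<theta> = (\<lambda>(x, y)\<in>X \<times> X.
     if \<exists>B\<in>eventual_partition \<theta>. x \<in> B \<and> y \<in> B
     then let B = (THE B. B \<in> eventual_partition \<theta> \<and> x \<in> B \<and> y \<in> B)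
          in \<Psi> B (block_dendrogram \<theta> B) (x, y)
     else diam \<theta> + \<epsilon>)"

end

theory Submission
  imports Defs
begin

text \<open>Two points lying in a common block of the eventual partition are joined by \<open>\<theta>\<close> at a first time
  \<open>l \<le> diam \<theta>\<close>. Replacing \<open>\<theta>\<close> by \<open>{X}\<close> from time \<open>diam \<theta> + \<epsilon> \<ge> l\<close> on does not change this time,
  not even when \<open>\<epsilon> = 0\<close>. All other pairs are never joined by \<open>\<theta>\<close>, hence are joined by the completion
  exactly at time \<open>diam \<theta> + \<epsilon>\<close>.\<close>

text \<open>The infimum s of the times satisfying \<open>P\<close> satisfies \<open>P\<close>
  itself: some such time lies below s + \<delta>, monotonicity carries \<open>P\<close> up to s +
  \<delta>, and \<open>right\<close> brings it back to s.\<close>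

lemma Least_nonneg_attained:
  fixes P :: "real \<Rightarrow> bool"
  assumes ex: "0 \<le> t\<^sub>0" "P t\<^sub>0"
    and up: "\<forall>s t. 0 \<le> s \<longrightarrow> s \<le> t \<longrightarrow> P s \<longrightarrow> P t"
    and right: "\<forall>t\<ge>0. \<exists>\<delta>>0. P (t + \<delta>) \<longrightarrow> P t"
  shows "0 \<le> (LEAST t. 0 \<le> t \<and> P t)" "P (LEAST t. 0 \<le> t \<and> P t)"
    and "\<And>t. \<lbrakk>0 \<le> t; P t\<rbrakk> \<Longrightarrow> (LEAST t. 0 \<le> t \<and> P t) \<le> t"
proof -
  let ?S = "{t. 0 \<le> t \<and> P t}"
  define s where "s = Inf ?S"
  have bdd: "bdd_below ?S" by (rule bdd_belowI[of _ 0]) auto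
  have ne: "?S \<noteq> {}" using ex by auto
  have s0: "0 \<le> s" unfolding s_def using ne by (intro cInf_greatest) auto
  have low: "s \<le> t" if "0 \<le> t" "P t" for t
    unfolding s_def using that bdd by (intro cInf_lower) auto
  obtain \<delta> where \<delta>: "\<delta> > 0" "P (s + \<delta>) \<longrightarrow> P s" using right s0 by blast
  have "Inf ?S < s + \<delta>" using \<delta> s_def by simp
  then obtain t where "0 \<le> t" "P t" "t < s + \<delta>" using cInf_lessD[OF ne] by auto
  then have Ps: "P s" using up \<delta> by (meson less_imp_le)
  have eq: "(LEAST t. 0 \<le> t \<and> P t) = s"
    using s0 Ps low by (intro Least_equality) auto
  show "0 \<le> (LEAST t. 0 \<le> t \<and> P t)" "P (LEAST t. 0 \<le> t \<and> P t)"
    "\<And>t. \<lbrakk>0 \<le> t; P t\<rbrakk> \<Longrightarrow> (LEAST t. 0 \<le> t \<and> P t) \<le> t"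
    unfolding eq using s0 Ps low by auto
qed

lemma refines_joined:
  assumes "refines X P Q" "\<exists>B\<in>P. x \<in> B \<and> y \<in> B"
  shows "\<exists>B\<in>Q. x \<in> B \<and> y \<in> B"
  using assms unfolding refines_def by blast

context
  fixes X :: "'a set" and r :: "'a rel" and \<theta> :: "real \<Rightarrow> 'a set set"
  assumes finX: "finite X" and \<theta>: "\<theta> \<in> partial_dendrograms X r"
begin

lemma partial_dendrogram_refines: "0 \<le> s \<Longrightarrow> s \<le> t \<Longrightarrow> refines X (\<theta> s) (\<theta> t)"
  using \<theta> unfolding partial_dendrograms_def monotone_on_def by auto

text \<open>D1 for an arbitrary property \<open>Q\<close> of the partition, shaped to supply the
  assumption \<open>right\<close> of \<open>Least_nonneg_attained\<close>; \<open>Q\<close> will be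
  equality with the eventual partition or the joining of two points.\<close>

lemma partial_dendrogram_right: "0 \<le> t \<Longrightarrow> \<exists>\<delta>>0. Q (\<theta> (t + \<delta>)) \<longrightarrow> Q (\<theta> t)"
  using \<theta> unfolding partial_dendrograms_def mem_Collect_eq by metis

lemma partial_dendrogram_partition: "0 \<le> t \<Longrightarrow> partition_on X (\<theta> t)"
  \<comment> \<open>\<open>refines\<close> includes that both its arguments are partitions of
    \<open>X\<close>.\<close>
  using partial_dendrogram_refines[of t t] by (simp add: refines_def)

text \<open>A monotone map into a finite set of partitions stabilises: the set of values that are
  coarser than or equal to \<open>\<theta> t\<close> can only shrink with \<open>t\<close>, and once
  its size is minimal \<open>\<theta>\<close> no longer changes.\<close>

lemma partial_dendrogram_eventually:
  obtains T where "0 \<le> T" "\<And>t. T \<le> t \<Longrightarrow> \<theta> t = eventual_partition \<theta>"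
proof -
  have "\<theta> ` {0..} \<subseteq> Pow (Pow X)"
    using partial_dendrogram_partition by (fastforce simp: partition_on_def)
  then have fin: "finite (\<theta> ` {0..})"
    using finX by (meson finite_Pow_iff finite_subset)
  have "\<exists>T\<ge>0. \<forall>t\<ge>T. \<theta> t = \<theta> T"
  proof -
    define c where "c P = card {Q \<in> \<theta> ` {0..}. refines X P Q}" for P
    obtain T where T: "0 \<le> T" "\<And>t. 0 \<le> t \<Longrightarrow> c (\<theta> T) \<le> c (\<theta> t)"
      using ex_has_least_nat[of "\<lambda>t. 0 \<le> t" 0 "\<lambda>t. c (\<theta> t)"] by auto
    have "\<theta> t = \<theta> T" if "T \<le> t" for t
    proof -
      have t: "0 \<le> t" and ref: "refines X (\<theta> T) (\<theta> t)"
        using T that partial_dendrogram_refines by auto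
      let ?A = "\<lambda>P. {Q \<in> \<theta> ` {0..}. refines X P Q}"
      have "?A (\<theta> t) \<subseteq> ?A (\<theta> T)" using ref refines_trans by blast
      moreover have "card (?A (\<theta> T)) \<le> card (?A (\<theta> t))" using T(2)[OF t] by (simp add: c_def)
      ultimately have "?A (\<theta> t) = ?A (\<theta> T)" using fin by (intro card_seteq) auto
      \<comment> \<open>By reflexivity \<open>\<theta> T\<close> is in its own set, hence in that of
        \<open>\<theta> t\<close>; this is refinement in the reverse direction.\<close>
      moreover have "\<theta> T \<in> ?A (\<theta> T)" using T(1) partial_dendrogram_refines[of T T] by auto
      ultimately have "refines X (\<theta> t) (\<theta> T)" by blast
      with ref show ?thesis using refines_asym by blast
    qed
    with T(1) show ?thesis by blast
  qed
  then obtain T where T: "0 \<le> T" "\<And>t. T \<le> t \<Longrightarrow> \<theta> t = \<theta> T" by blast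
  have "eventual_partition \<theta> = \<theta> T"
    unfolding eventual_partition_def
  proof (rule the_equality)
    show ev: "\<forall>\<^sub>F t in at_top. \<theta> t = \<theta> T"
      unfolding eventually_at_top_linorder using T(2) by blast
    show "P = \<theta> T" if "\<forall>\<^sub>F t in at_top. \<theta> t = P" for P
    proof -
      \<comment> \<open>Two eventual values agree at some common time, as \<open>at_top\<close> on
        the reals is a nontrivial filter.\<close>
      have "\<forall>\<^sub>F t :: real in at_top. P = \<theta> T" using that ev by eventually_elim simp
      then show ?thesis by (simp add: eventually_const)
    qed
  qed
  with T show thesis by (metis that)
qed

text \<open>Having reached the eventual partition is a property that persists in time, so
  \<open>Least_nonneg_attained\<close> shows that the minimum defining \<open>diam\<close> is
  attained.\<close>

lemma diam_nonneg: "0 \<le> diam \<theta>"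
  and diam_eventual: "\<And>t. diam \<theta> \<le> t \<Longrightarrow> \<theta> t = eventual_partition \<theta>"
proof -
  let ?P = "\<lambda>t. \<theta> t = eventual_partition \<theta>"
  obtain T where T: "0 \<le> T" "\<And>t. T \<le> t \<Longrightarrow> ?P t"
    using partial_dendrogram_eventually by blast
  have up: "?P t" if "0 \<le> s" "s \<le> t" "?P s" for s t
  proof -
    \<comment> \<open>The time \<open>max t T\<close> is after \<open>t\<close> and in the stable
      range, so \<open>\<theta> t\<close> is squeezed between two equal partitions.\<close>
    have "refines X (\<theta> t) (\<theta> (max t T))"
      using that(1,2) by (intro partial_dendrogram_refines) auto
    moreover have "\<theta> (max t T) = \<theta> s" unfolding that(3) by (rule T(2)) simp
    ultimately have "\<theta> s = \<theta> t"
      using refines_asym partial_dendrogram_refines[OF that(1,2)] by metis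
    with that(3) show ?thesis by (simp only:)
  qed
  have up': "\<forall>s t. 0 \<le> s \<longrightarrow> s \<le> t \<longrightarrow> ?P s \<longrightarrow> ?P t"
    by (intro allI impI) (rule up)
  have right: "\<forall>t\<ge>0. \<exists>\<delta>>0. ?P (t + \<delta>) \<longrightarrow> ?P t"
    using partial_dendrogram_right[where Q = "\<lambda>Q. Q = eventual_partition \<theta>"] by blast
  note least =
    Least_nonneg_attained[of T ?P, OF T(1) T(2)[OF order_refl] up' right, folded diam_def]
  show "0 \<le> diam \<theta>" by (rule least(1))
  show "?P t" if "diam \<theta> \<le> t" for t using up[OF least(1) that least(2)] .
qed

lemma joined_imp_eventually_joined:
  assumes "0 \<le> t" "\<exists>B\<in>\<theta> t. x \<in> B \<and> y \<in> B"
  shows "\<exists>B\<in>eventual_partition \<theta>. x \<in> B \<and> y \<in> B"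
proof -
  have "\<theta> (max t (diam \<theta>)) = eventual_partition \<theta>" by (rule diam_eventual) simp
  then have "refines X (\<theta> t) (eventual_partition \<theta>)"
    using partial_dendrogram_refines[OF assms(1), of "max t (diam \<theta>)"] by simp
  then show ?thesis using assms(2) by (rule refines_joined)
qed

text \<open>When both points lie in \<open>B\<close>, a block of \<open>\<theta> t\<close> contains
  them iff its intersection with \<open>B\<close> does, so restricting to \<open>B\<close> leaves
  their joining time unchanged.\<close>

lemma ultrametric_joined:
  assumes "x \<in> X" "y \<in> X" and joined: "\<exists>B\<in>eventual_partition \<theta>. x \<in> B \<and> y \<in> B"
  shows "\<UU> X \<epsilon> \<theta> (x, y) = (LEAST t. 0 \<le> t \<and> (\<exists>B\<in>\<theta> t. x \<in> B \<and> y \<in> B))"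
proof -
  obtain B where B: "B \<in> eventual_partition \<theta>" "x \<in> B" "y \<in> B" using joined by blast
  have "partition_on X (eventual_partition \<theta>)"
    using partial_dendrogram_partition[OF diam_nonneg] diam_eventual by simp
  then have "disjoint (eventual_partition \<theta>)" by (rule partition_onD2)
  then have the: "(THE B. B \<in> eventual_partition \<theta> \<and> x \<in> B \<and> y \<in> B) = B"
    using B by (intro the_equality) (metis disjointD disjoint_iff)+
  have "(\<exists>C\<in>block_dendrogram \<theta> B t. x \<in> C \<and> y \<in> C) \<longleftrightarrow> (\<exists>C\<in>\<theta> t. x \<in> C \<and> y \<in> C)"
    if "0 \<le> t" for t
    using B that unfolding block_dendrogram_def by auto
  \<comment> \<open>Off the nonnegative reals \<open>block_dendrogram\<close> is
    \<open>undefined\<close>; with the guard on both sides the equivalence holds for all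
    \<open>t\<close> and can be rewritten under \<open>LEAST\<close>.\<close>
  then have "(0 \<le> t \<and> (\<exists>C\<in>block_dendrogram \<theta> B t. x \<in> C \<and> y \<in> C)) \<longleftrightarrow>
      (0 \<le> t \<and> (\<exists>C\<in>\<theta> t. x \<in> C \<and> y \<in> C))" for t by blast
  then show ?thesis
    using assms B the by (simp add: ultrametric_completion_def dendrogram_ultrametric_def Let_def)
qed

lemma dendrogram_ultrametric_completion:
  assumes "0 \<le> \<epsilon>"
  shows "\<Psi> X (\<kappa> X \<epsilon> \<theta>) = \<UU> X \<epsilon> \<theta>"
proof -
  have "\<Psi> X (\<kappa> X \<epsilon> \<theta>) (x, y) = \<UU> X \<epsilon> \<theta> (x, y)" if xy: "x \<in> X" "y \<in> X" for x y
  proof -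
    let ?J = "\<lambda>\<eta> t. \<exists>B\<in>\<eta> t. x \<in> B \<and> y \<in> B"
    have \<Psi>: "\<Psi> X (\<kappa> X \<epsilon> \<theta>) (x, y) = (LEAST t. 0 \<le> t \<and> ?J (\<kappa> X \<epsilon> \<theta>) t)"
      using xy by (simp add: dendrogram_ultrametric_def)
    \<comment> \<open>From \<open>diam \<theta> + \<epsilon>\<close> on, the single block
      \<open>X\<close> joins every pair.\<close>
    have J: "?J (\<kappa> X \<epsilon> \<theta>) t \<longleftrightarrow> diam \<theta> + \<epsilon> \<le> t \<or> ?J \<theta> t" if "0 \<le> t" for t
      using that xy by (auto simp: dendrogram_completion_def)
    show ?thesis
    proof (cases "\<exists>B\<in>eventual_partition \<theta>. x \<in> B \<and> y \<in> B")
      case True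
      define l where "l = (LEAST t. 0 \<le> t \<and> ?J \<theta> t)"
      have J_diam: "?J \<theta> (diam \<theta>)" using True diam_eventual by simp
      have right: "\<forall>t\<ge>0. \<exists>\<delta>>0. ?J \<theta> (t + \<delta>) \<longrightarrow> ?J \<theta> t"
        using partial_dendrogram_right[where Q = "\<lambda>P. \<exists>B\<in>P. x \<in> B \<and> y \<in> B"] by blast
      have up: "\<forall>s t. 0 \<le> s \<longrightarrow> s \<le> t \<longrightarrow> ?J \<theta> s \<longrightarrow> ?J \<theta> t"
      proof (intro allI impI)
        fix s t
        assume "0 \<le> s" "s \<le> t" and J: "?J \<theta> s"
        then have "refines X (\<theta> s) (\<theta> t)" by (intro partial_dendrogram_refines)
        then show "?J \<theta> t" using J by (rule refines_joined)
      qed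
      note least =
        Least_nonneg_attained[of "diam \<theta>" "?J \<theta>", OF diam_nonneg J_diam up right, folded l_def]
      have "l \<le> diam \<theta>" using least(3)[OF diam_nonneg J_diam] .
      have "(LEAST t. 0 \<le> t \<and> ?J (\<kappa> X \<epsilon> \<theta>) t) = l"
      proof (rule Least_equality)
        show "0 \<le> l \<and> ?J (\<kappa> X \<epsilon> \<theta>) l" using least(1,2) J by blast
        show "l \<le> t" if "0 \<le> t \<and> ?J (\<kappa> X \<epsilon> \<theta>) t" for t
        \<comment> \<open>A late time exceeds \<open>l\<close> because \<epsilon> is nonnegative; at
          an earlier time the completion still agrees with \<open>\<theta>\<close>.\<close>
        proof (cases "diam \<theta> + \<epsilon> \<le> t")
          case True
          with \<open>l \<le> diam \<theta>\<close> assms show ?thesis by linarith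
        next
          case False
          with that J have "?J \<theta> t" by blast
          with that show ?thesis using least(3) by blast
        qed
      qed
      then show ?thesis using \<Psi> ultrametric_joined[OF xy True] by (simp add: l_def)
    next
      case False
      then have nJ: "\<not> ?J \<theta> t" if "0 \<le> t" for t using joined_imp_eventually_joined[OF that] by blast
      have "(LEAST t. 0 \<le> t \<and> ?J (\<kappa> X \<epsilon> \<theta>) t) = diam \<theta> + \<epsilon>"
      proof (rule Least_equality)
        show "0 \<le> diam \<theta> + \<epsilon> \<and> ?J (\<kappa> X \<epsilon> \<theta>) (diam \<theta> + \<epsilon>)"
          using J[of "diam \<theta> + \<epsilon>"] assms diam_nonneg by simp
        show "diam \<theta> + \<epsilon> \<le> t" if "0 \<le> t \<and> ?J (\<kappa> X \<epsilon> \<theta>) t" for t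
          using J[of t] nJ[of t] that by blast
      qed
      then show ?thesis using False xy \<Psi> by (auto simp: ultrametric_completion_def)
    qed
  qed
  \<comment> \<open>Both functions are extensional, so agreement on \<open>X \<times> X\<close> is
    equality.\<close>
  then show ?thesis
    by (intro extensionalityI[of _ "X \<times> X"])
      (auto simp: dendrogram_ultrametric_def ultrametric_completion_def)
qed

end

theorem theorem19:
  fixes X :: "'a set" and r :: "'a rel" and \<epsilon> :: real
  assumes "finite X" and "X \<noteq> {}" and "strict_poset X r" and "\<epsilon> \<ge> 0"
  shows "\<forall>\<theta> \<in> partial_dendrograms X r. \<Psi> X (\<kappa> X \<epsilon> \<theta>) = \<UU> X \<epsilon> \<theta>"
  by (intro ballI dendrogram_ultrametric_completion[OF assms(1) _ assms(4)])

end
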